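(* Let $\mu,\nu\in\mathcal P$ with $r_\nu\leq\ell_\mu$ and $\mu(\{\ell_\mu\})\wedge\nu(\{\ell_\mu\})=0$. Let $G=G_\mu$ be the left-continuous quantile function of $\mu$ and let $T(u)=R_{\mu,\nu}(u)$, $u\in(0,1)$, with $R_{\mu,\nu}$ as defined in the context. Let $U,V$ be independent uniform random variables on $(0,1)$, and set $X=G(U)$, $Y=T(U)$. Then $T$ is non-increasing, $T<G$ on $(0,1)$, $(X,Y)$ is a supermartingale with respect to $(\sigma(U),\sigma(U,V))$, $X$ has law $\mu$ and $Y$ has law $\nu$. In particular, $T$ defines the lifted increasing supermartingale coupling, i.e. for every $u\in(0,1)$ and Borel $B\subseteq\mathbb R$, $\mathbb P(U\leq u,\ Y\in B)=S^\nu(\mu_u)(B)$, and this coincides with the lifted antitone coupling, i.e. the law of $(U,X,Y)$ equals the law of $(U,G_\mu(U),G_\nu(1-U))$.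
   Context: $\mathcal M$: finite Borel measures on $\mathbb R$ with finite first moment; $\mathcal P$: probability measures in $\mathcal M$. $\ell_\eta,r_\eta$ are the left and right endpoints of the smallest interval containing the support of $\eta$. $P_\eta(k)=\int(k-x)^+\eta(dx)$. $\eta\leq\chi$ means $\eta(A)\le\chi(A)$ for all Borel $A$; $\eta\leq_{cd}\chi$ means $\int f\,d\eta\leq\int f\,d\chi$ for all convex non-increasing $f:\mathbb R\to\mathbb R$; $\eta\leq_{pcd}\chi$ means the same for all non-negative convex non-increasing $f$. If $\eta\leq_{pcd}\chi$, the shadow $S^\chi(\eta)$ is the unique measure $\theta$ with $\eta\leq_{cd}\theta\leq\chi$ such that $\theta\leq_{cd}\theta'$ whenever $\eta\leq_{cd}\theta'\leq\chi$. (Under the hypotheses on the supports, $\mu\leq_{cd}\nu$.) $f^c$ is the largest convex function below $f$; $\partial f$ is the subdifferential. For $\eta\in\mathcal M$ with $m=\eta(\mathbb R)$, $G_\eta(u)=\sup\{k:\eta((-\infty,k])<u\}$, $u\in(0,m)$, is the left-continuous quantile function, and $\eta_u=\eta|_{(-\infty,G_\eta(u))}+\big(u-\eta((-\infty,G_\eta(u)))\big)\delta_{G_\eta(u)}$. For $\eta\leq_{cd}\chi$ with common mass $m$, set $D_{\eta,\chi}=P_\chi-P_\eta$ and, for $u\in(0,m)$, $\mathcal E_u=P_\chi-P_{\eta_u}$, $\phi_{\eta,\chi}(u)=\inf\partial(\mathcal E_u^c)(G_\eta(u))$, and $R_{\eta,\chi}(u)=\inf\{k\leq G_\eta(u):D_{\eta,\chi}(k)=\mathcal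 E_u^c(G_\eta(u))+\phi_{\eta,\chi}(u)(k-G_\eta(u))\}$. *)

theory Defs
  imports "HOL-Probability.Probability"
begin

definition fin_moment :: "real measure set" where
  "fin_moment = {\<eta>. sets \<eta> = sets borel \<and> finite_measure \<eta> \<and> integrable \<eta> (\<lambda>x. x)}"

definition prob_fin_moment :: "real measure set" where
  "prob_fin_moment = {\<eta> \<in> fin_moment. prob_space \<eta>}"

definition supp :: "real measure \<Rightarrow> real set" where
  "supp \<eta> = {x. \<forall>A. open A \<and> x \<in> A \<longrightarrow> emeasure \<eta> A > 0}"

text \<open>On the line the convex hull of a set is the smallest interval containing it.\<close>

definition left_end :: "real measure \<Rightarrow> ereal" where
  "left_end \<eta> = Inf (ereal ` (convex hull (supp \<eta>)))"

definition right_end :: "real measure \<Rightarrow> ereal" where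
  "right_end \<eta> = Sup (ereal ` (convex hull (supp \<eta>)))"

definition put :: "real measure \<Rightarrow> real \<Rightarrow> real" where
  "put \<eta> k = (\<integral>x. max 0 (k - x) \<partial>\<eta>)"

text \<open>The integral with values in the extended reals. A convex function lies above an affine one,
  so its negative part is integrable against every measure in \<^const>\<open>fin_moment\<close>, but the positive
  part need not be; the Bochner integral would then have the wrong value 0 instead of infinity.\<close>

definition ext_integral :: "real measure \<Rightarrow> (real \<Rightarrow> real) \<Rightarrow> ereal" where
  "ext_integral \<eta> f =
     enn2ereal (\<integral>\<^sup>+x. ennreal (f x) \<partial>\<eta>) - enn2ereal (\<integral>\<^sup>+x. ennreal (- f x) \<partial>\<eta>)"

text \<open>Convex-decreasing order.\<close>

definition le_cd :: "real measure \<Rightarrow> real measure \<Rightarrow> bool" where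
  "le_cd \<eta> \<kappa> \<longleftrightarrow>
     (\<forall>f. convex_on UNIV f \<and> antimono f \<longrightarrow> ext_integral \<eta> f \<le> ext_integral \<kappa> f)"

text \<open>All measures involved live on the Borel sets, and there the library order on measures
  is the setwise one (\<open>le_measure\<close>). The shadow exists precisely when \<open>\<eta>\<close> is below \<open>\<kappa>\<close> in the
  positive convex-decreasing order, and is then unique.\<close>

definition is_shadow :: "real measure \<Rightarrow> real measure \<Rightarrow> real measure \<Rightarrow> bool" where
  "is_shadow \<kappa> \<eta> \<theta> \<longleftrightarrow>
     \<theta> \<in> fin_moment \<and> le_cd \<eta> \<theta> \<and> \<theta> \<le> \<kappa> \<and>
     (\<forall>\<theta>' \<in> fin_moment. le_cd \<eta> \<theta>' \<and> \<theta>' \<le> \<kappa> \<longrightarrow> le_cd \<theta> \<theta>')"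

definition shadow :: "real measure \<Rightarrow> real measure \<Rightarrow> real measure" where
  "shadow \<kappa> \<eta> = (THE \<theta>. is_shadow \<kappa> \<eta> \<theta>)"

text \<open>Largest convex minorant, with respect to the pointwise order on functions.\<close>

definition convex_minorant :: "(real \<Rightarrow> real) \<Rightarrow> real \<Rightarrow> real" where
  "convex_minorant f = (GREATEST g. convex_on UNIV g \<and> g \<le> f)"

definition subdiff :: "(real \<Rightarrow> real) \<Rightarrow> real \<Rightarrow> real set" where
  "subdiff f x = {s. \<forall>y. f x + s * (y - x) \<le> f y}"

text \<open>The functions of \<open>u\<close> below are meaningful for \<open>u\<close> strictly between 0 and the total mass
  of \<open>\<eta>\<close>.\<close>

definition quantile :: "real measure \<Rightarrow> real \<Rightarrow> real" where
  "quantile \<eta> u = Sup {k. measure \<eta> {..k} < u}"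

text \<open>The measure \<open>\<eta>\<^sub>u\<close>: the restriction of \<open>\<eta>\<close> to the open half-line left of \<open>quantile \<eta> u\<close>,
  plus an atom at \<open>quantile \<eta> u\<close> that brings the total mass to \<open>u\<close>.\<close>

definition left_part :: "real measure \<Rightarrow> real \<Rightarrow> real measure" where
  "left_part \<eta> u = measure_of UNIV (sets borel) (\<lambda>A.
     emeasure \<eta> (A \<inter> {..<quantile \<eta> u}) +
     ennreal (u - measure \<eta> {..<quantile \<eta> u}) * indicator A (quantile \<eta> u))"

definition D_fun :: "real measure \<Rightarrow> real measure \<Rightarrow> real \<Rightarrow> real" where
  "D_fun \<eta> \<kappa> k = put \<kappa> k - put \<eta> k"

definition E_fun :: "real measure \<Rightarrow> real measure \<Rightarrow> real \<Rightarrow> real \<Rightarrow> real" where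
  "E_fun \<eta> \<kappa> u k = put \<kappa> k - put (left_part \<eta> u) k"

definition phi_fun :: "real measure \<Rightarrow> real measure \<Rightarrow> real \<Rightarrow> real" where
  "phi_fun \<eta> \<kappa> u = Inf (subdiff (convex_minorant (E_fun \<eta> \<kappa> u)) (quantile \<eta> u))"

definition R_fun :: "real measure \<Rightarrow> real measure \<Rightarrow> real \<Rightarrow> real" where
  "R_fun \<eta> \<kappa> u = Inf {k. k \<le> quantile \<eta> u \<and>
     D_fun \<eta> \<kappa> k = convex_minorant (E_fun \<eta> \<kappa> u) (quantile \<eta> u)
                     + phi_fun \<eta> \<kappa> u * (k - quantile \<eta> u)}"

text \<open>\<open>(X, Y)\<close> is a supermartingale on \<open>M\<close> for the two-step filtration \<open>(F1, F2)\<close>.\<close>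

definition two_step_supermartingale ::
    "'w measure \<Rightarrow> 'w measure \<Rightarrow> 'w measure \<Rightarrow> ('w \<Rightarrow> real) \<Rightarrow> ('w \<Rightarrow> real) \<Rightarrow> bool" where
  "two_step_supermartingale M F1 F2 X Y \<longleftrightarrow>
     subalgebra M F2 \<and> subalgebra F2 F1 \<and>
     X \<in> borel_measurable F1 \<and> Y \<in> borel_measurable F2 \<and>
     integrable M X \<and> integrable M Y \<and>
     (AE w in M. real_cond_exp M F1 Y w \<le> X w)"

end

theory Submission
  imports Defs
begin

text \<open>
  Write \<open>l\<close> for the left end of \<open>\<mu>\<close>: it is finite, \<open>\<mu>\<close> lives on \<open>[l, \<infinity>)\<close> and \<open>\<nu>\<close> on
  \<open>(-\<infinity>, l]\<close> (\<open>separating_point\<close>). The whole statement follows from the pointwise identity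
  \<open>T u = quantile \<nu> (1 - u)\<close>, which is \<open>R_fun_eq_quantile\<close>.

  For that identity put \<open>q = quantile \<nu> (1 - u)\<close> and \<open>\<kappa> = left_part \<nu> (1 - u)\<close>. The largest
  convex function below \<open>put \<nu> - put (left_part \<mu> u)\<close> is \<open>put \<kappa>\<close>
  (\<open>convex_minorant_put_diff\<close>). Indeed the given function agrees with \<open>put \<nu>\<close>, hence with
  \<open>put \<kappa>\<close>, up to \<open>q\<close>, and it grows with slope \<open>1 - u\<close> at infinity; a convex minorant therefore has
  slope at most \<open>1 - u\<close>, and \<open>put \<kappa>\<close> is the function that continues \<open>put \<nu>\<close> beyond \<open>q\<close> with
  exactly this slope. The quantile of \<open>\<mu>\<close> at \<open>u\<close> lies strictly to the right of \<open>q\<close>: both could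
  only be equal to \<open>l\<close>, and then both measures would charge \<open>l\<close> (\<open>quantiles_separated\<close>). So the
  supporting line at this quantile is the line that \<open>put \<kappa>\<close> follows on \<open>[q, \<infinity>)\<close>. Up to \<open>q\<close>
  the function \<open>D_fun \<mu> \<nu>\<close> equals \<open>put \<kappa>\<close>, which stays strictly above that line before \<open>q\<close>, and
  so \<open>q\<close> is the first point at which the two meet.

  Monotonicity of \<open>T\<close>, the laws of \<open>X\<close> and \<open>Y\<close>, and the agreement with the antitone coupling are
  then facts about quantile functions. The supermartingale property holds because \<open>Y\<close> is
  a function of \<open>U\<close> and lies below \<open>X\<close>. For the shadow, the law of \<open>Y\<close> on the event \<open>U \<le> u\<close> is
  the upper part of mass \<open>u\<close> of \<open>\<nu>\<close>. Among the submeasures of \<open>\<nu>\<close> with this mass the upper part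
  is the smallest in the convex-decreasing order, and it dominates \<open>left_part \<mu> u\<close> because it
  lies to its left; both comparisons are instances of the one-crossing criterion
  \<open>le_cd_crossing\<close>.
\<close>

section \<open>Quantile functions\<close>

text \<open>The library's pseudo-inverse of a distribution function is the infimum of
  \<open>{x. u \<le> cdf \<eta> x}\<close>, while \<^const>\<open>quantile\<close> is the supremum of the complement. The two
  sets are complementary half-lines, so the Galois connection carries over.\<close>

lemma quantile_le_iff:
  assumes "real_distribution \<eta>" "0 < u" "u < 1"
  shows "quantile \<eta> u \<le> x \<longleftrightarrow> u \<le> measure \<eta> {..x}"
proof -
  interpret cdf_distribution \<eta>
    using assms(1) by (simp add: cdf_distribution_def)
  obtain a where a: "\<And>x. u \<le> measure \<eta> {..x} \<longleftrightarrow> a \<le> x"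
    using pseudoinverse[OF assms(2,3)] unfolding cdf_def by blast
  have "{k. measure \<eta> {..k} < u} = {..<a}"
    unfolding set_eq_iff mem_Collect_eq lessThan_iff by (metis a not_le)
  hence "quantile \<eta> u = a"
    by (simp add: quantile_def)
  thus ?thesis using a by simp
qed

lemma quantile_mono:
  assumes "real_distribution \<eta>" "0 < u" "u \<le> v" "v < 1"
  shows "quantile \<eta> u \<le> quantile \<eta> v"
  using quantile_le_iff[OF assms(1), of v "quantile \<eta> v"]
    quantile_le_iff[OF assms(1), of u "quantile \<eta> v"] assms by simp

lemma measure_atMost_eq:
  assumes "real_distribution \<eta>"
  shows "measure \<eta> {..x} = measure \<eta> {..<x} + measure \<eta> {x}"
proof -
  interpret real_distribution \<eta> by fact
  have "measure \<eta> ({..<x} \<union> {x}) = measure \<eta> {..<x} + measure \<eta> {x}"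
    by (rule finite_measure_Union) auto
  moreover have "{..<x} \<union> {x} = {..x}" by auto
  ultimately show ?thesis by simp
qed

lemma quantile_between:
  assumes "real_distribution \<eta>" "0 < u" "u < 1"
  shows "measure \<eta> {..<quantile \<eta> u} \<le> u"
    and "u \<le> measure \<eta> {..<quantile \<eta> u} + measure \<eta> {quantile \<eta> u}"
proof -
  interpret real_distribution \<eta> by fact
  let ?q = "quantile \<eta> u"
  have "cdf \<eta> k \<le> u" if "k < ?q" for k
    using quantile_le_iff[OF assms, of k] that by (simp add: cdf_def)
  hence "eventually (\<lambda>k. cdf \<eta> k \<le> u) (at_left ?q)"
    by (intro eventually_at_leftI[of "?q - 1"]) auto
  thus "measure \<eta> {..<?q} \<le> u"
    by (intro tendsto_upperbound[OF cdf_at_left]) auto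
  show "u \<le> measure \<eta> {..<?q} + measure \<eta> {?q}"
    using quantile_le_iff[OF assms, of ?q] measure_atMost_eq[OF assms(1)] by simp
qed

text \<open>Stated for an arbitrary measurable space, so that it also yields measurability with respect
  to the \<open>\<sigma>\<close>-algebra generated by a single random variable.\<close>

lemma measurable_quantile_compose:
  assumes \<eta>: "real_distribution \<eta>" and W: "W \<in> borel_measurable N"
    and range: "\<And>w. w \<in> space N \<Longrightarrow> W w \<in> {0<..<1}"
  shows "(\<lambda>w. quantile \<eta> (W w)) \<in> borel_measurable N"
proof (subst borel_measurable_iff_le, intro allI)
  fix x
  have "{w \<in> space N. quantile \<eta> (W w) \<le> x} = {w \<in> space N. W w \<le> measure \<eta> {..x}}"
    using quantile_le_iff[OF \<eta>] range by auto
  also have "\<dots> \<in> sets N"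
    using W by measurable
  finally show "{w \<in> space N. quantile \<eta> (W w) \<le> x} \<in> sets N" .
qed

text \<open>Inverse transform sampling. Uniformity is assumed in the form of the distribution function
  because it is applied to both \<open>U\<close> and \<open>1 - U\<close>.\<close>

lemma (in prob_space) distr_quantile_uniform:
  assumes \<eta>: "real_distribution \<eta>" and W: "random_variable borel W"
    and range: "\<And>w. w \<in> space M \<Longrightarrow> W w \<in> {0<..<1}"
    and unif: "\<And>a. 0 \<le> a \<Longrightarrow> a \<le> 1 \<Longrightarrow> prob {w \<in> space M. W w \<le> a} = a"
  shows "distr M borel (\<lambda>w. quantile \<eta> (W w)) = \<eta>"
proof (rule cdf_unique)
  interpret \<eta>: real_distribution \<eta> by fact
  have meas: "random_variable borel (\<lambda>w. quantile \<eta> (W w))"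
    using measurable_quantile_compose[OF \<eta> W range] .
  thus "real_distribution (distr M borel (\<lambda>w. quantile \<eta> (W w)))" by simp
  show "cdf (distr M borel (\<lambda>w. quantile \<eta> (W w))) = cdf \<eta>"
  proof
    fix x
    have "cdf (distr M borel (\<lambda>w. quantile \<eta> (W w))) x =
        prob {w \<in> space M. quantile \<eta> (W w) \<le> x}"
      using meas by (auto simp: cdf_def measure_distr intro!: arg_cong[where f=prob])
    also have "{w \<in> space M. quantile \<eta> (W w) \<le> x} = {w \<in> space M. W w \<le> measure \<eta> {..x}}"
      using quantile_le_iff[OF \<eta>] range by auto
    also have "prob \<dots> = measure \<eta> {..x}"
      by (intro unif) auto
    finally show "cdf (distr M borel (\<lambda>w. quantile \<eta> (W w))) x = cdf \<eta> x"
      by (simp add: cdf_def)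
  qed
qed (fact \<eta>)

section \<open>Comparing integrals of ordered measures\<close>

lemma fin_moment_mono:
  assumes \<eta>: "\<eta> \<in> fin_moment" and sets: "sets \<theta> = sets borel" and le: "\<theta> \<le> \<eta>"
  shows "\<theta> \<in> fin_moment"
proof -
  interpret \<eta>: finite_measure \<eta> using \<eta> by (simp add: fin_moment_def)
  note [measurable_cong] = sets
  have s: "sets \<theta> = sets \<eta>" using \<eta> sets by (simp add: fin_moment_def)
  have "emeasure \<theta> (space \<theta>) \<le> emeasure \<eta> (space \<theta>)"
    using le_measureD3[OF le s] .
  also have "\<dots> < \<infinity>"
    using \<eta>.emeasure_finite by (simp add: less_top[symmetric])
  finally have fin: "finite_measure \<theta>"
    by (intro finite_measureI) auto
  have "(\<integral>\<^sup>+x. ennreal (norm x) \<partial>\<theta>) \<le> (\<integral>\<^sup>+x. ennreal (norm x) \<partial>\<eta>)"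
    using s le by (rule nn_integral_mono_measure)
  also have "\<dots> < \<infinity>"
    using \<eta> by (auto simp: fin_moment_def integrable_iff_bounded)
  finally have "integrable \<theta> (\<lambda>x. x)"
    by (simp add: integrable_iff_bounded)
  thus ?thesis using fin sets by (simp add: fin_moment_def)
qed

text \<open>The setwise order of two measures is needed only where the integrand lives: cutting both
  measures down to \<open>S\<close> by a density reduces this to measures that are ordered everywhere.\<close>

lemma nn_integral_mono_measure_on:
  fixes \<alpha> \<beta> :: "real measure" and f :: "real \<Rightarrow> ennreal"
  assumes sets: "sets \<alpha> = sets borel" "sets \<beta> = sets borel"
    and S: "S \<in> sets borel" and f: "f \<in> borel_measurable borel"
    and zero: "\<And>x. x \<notin> S \<Longrightarrow> f x = 0"
    and le: "\<And>A. A \<in> sets borel \<Longrightarrow> A \<subseteq> S \<Longrightarrow> emeasure \<alpha> A \<le> emeasure \<beta> A"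
  shows "(\<integral>\<^sup>+x. f x \<partial>\<alpha>) \<le> (\<integral>\<^sup>+x. f x \<partial>\<beta>)"
proof -
  note [measurable_cong] = sets
  note [measurable] = f S
  have eq: "(\<integral>\<^sup>+x. f x \<partial>\<gamma>) = (\<integral>\<^sup>+x. f x \<partial>density \<gamma> (indicator S))"
    if [measurable_cong]: "sets \<gamma> = sets borel" for \<gamma>
    by (subst nn_integral_density) (auto intro!: nn_integral_cong simp: zero split: split_indicator)
  have "density \<alpha> (indicator S) \<le> density \<beta> (indicator S)"
    by (subst le_measure)
       (auto simp: sets emeasure_density indicator_inter_arith[symmetric] intro!: le)
  thus ?thesis
    unfolding eq[OF sets(1)] eq[OF sets(2)]
    by (intro nn_integral_mono_measure) (auto simp: sets)
qed

section \<open>The left part of a probability measure\<close>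

text \<open>The defining formula is the measure it describes only once it is known to be countably
  additive. This holds because it is the measure with \<open>\<eta>\<close>-density 1 below the quantile and a
  constant density at the quantile itself.\<close>

lemma emeasure_left_part:
  assumes \<eta>: "real_distribution \<eta>" and u: "0 < u" "u < 1" and A: "A \<in> sets borel"
  shows "emeasure (left_part \<eta> u) A = emeasure \<eta> (A \<inter> {..<quantile \<eta> u}) +
     ennreal (u - measure \<eta> {..<quantile \<eta> u}) * indicator A (quantile \<eta> u)"
proof -
  interpret real_distribution \<eta> by fact
  define q where "q = quantile \<eta> u"
  \<comment> \<open>If the quantile is not an atom, the numerator vanishes too, so that 0 / 0 = 0 is the right value.\<close>
  define c where "c = (u - measure \<eta> {..<q}) / measure \<eta> {q}"
  define D where "D = density \<eta> (\<lambda>x. indicator {..<q} x + ennreal c * indicator {q} x)"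
  note b = quantile_between[OF \<eta> u, folded q_def]
  have c: "ennreal c * emeasure \<eta> {q} = ennreal (u - measure \<eta> {..<q})"
    using b by (auto simp: c_def emeasure_eq_measure ennreal_mult[symmetric])
  have D: "emeasure D A = emeasure \<eta> (A \<inter> {..<q}) +
      ennreal (u - measure \<eta> {..<q}) * indicator A q" if [measurable]: "A \<in> sets borel" for A
  proof -
    have "emeasure D A = (\<integral>\<^sup>+x. indicator (A \<inter> {..<q}) x + ennreal c * indicator (A \<inter> {q}) x \<partial>\<eta>)"
      unfolding D_def
      by (subst emeasure_density) (auto intro!: nn_integral_cong split: split_indicator)
    also have "\<dots> = emeasure \<eta> (A \<inter> {..<q}) + ennreal c * emeasure \<eta> (A \<inter> {q})"
      by (subst nn_integral_add) (auto simp: nn_integral_cmult)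
    also have "ennreal c * emeasure \<eta> (A \<inter> {q}) = ennreal (u - measure \<eta> {..<q}) * indicator A q"
      using c by (cases "q \<in> A") auto
    finally show ?thesis .
  qed
  have "left_part \<eta> u = measure_of UNIV (sets borel) (emeasure D)"
    unfolding left_part_def q_def[symmetric]
    by (intro measure_of_eq) (auto simp: D sets.sigma_sets_eq[of borel, simplified])
  also have "\<dots> = D"
    using measure_of_of_measure[of D] by (simp add: D_def)
  finally show ?thesis
    using D[OF A] by (simp add: q_def)
qed

lemma sets_left_part [simp, measurable_cong]: "sets (left_part \<eta> u) = sets borel"
  by (simp add: left_part_def sets.sigma_sets_eq[of borel, simplified])

lemma space_left_part [simp]: "space (left_part \<eta> u) = UNIV"
  by (simp add: left_part_def)

lemma measure_left_part:
  assumes \<eta>: "real_distribution \<eta>" and u: "0 < u" "u < 1"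
  shows "measure (left_part \<eta> u) UNIV = u"
proof -
  interpret real_distribution \<eta> by fact
  have "emeasure (left_part \<eta> u) UNIV = ennreal u"
    using quantile_between[OF \<eta> u] u
    by (simp add: emeasure_left_part[OF \<eta> u] emeasure_eq_measure ennreal_plus[symmetric]
        del: ennreal_plus)
  thus ?thesis using u by (simp add: measure_def)
qed

lemma left_part_le:
  assumes \<eta>: "real_distribution \<eta>" and u: "0 < u" "u < 1"
  shows "left_part \<eta> u \<le> \<eta>"
proof -
  interpret real_distribution \<eta> by fact
  let ?q = "quantile \<eta> u"
  have "emeasure (left_part \<eta> u) A \<le> emeasure \<eta> A" if A: "A \<in> sets borel" for A
  proof -
    have "ennreal (u - measure \<eta> {..<?q}) * indicator A ?q \<le> emeasure \<eta> (A \<inter> {?q})"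
      using quantile_between[OF \<eta> u]
      by (cases "?q \<in> A") (auto simp: emeasure_eq_measure intro!: ennreal_leI)
    hence "emeasure (left_part \<eta> u) A \<le> emeasure \<eta> (A \<inter> {..<?q}) + emeasure \<eta> (A \<inter> {?q})"
      by (simp add: emeasure_left_part[OF \<eta> u A])
    also have "\<dots> = emeasure \<eta> (A \<inter> {..<?q} \<union> A \<inter> {?q})"
      using A by (intro plus_emeasure) auto
    also have "\<dots> \<le> emeasure \<eta> A"
      using A by (intro emeasure_mono) auto
    finally show ?thesis .
  qed
  thus ?thesis by (simp add: le_measure)
qed

lemma left_part_above_quantile:
  assumes \<eta>: "real_distribution \<eta>" and u: "0 < u" "u < 1"
  shows "emeasure (left_part \<eta> u) {quantile \<eta> u<..} = 0"
proof -
  have "{quantile \<eta> u<..} \<inter> {..<quantile \<eta> u} = {}" by auto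
  thus ?thesis by (simp add: emeasure_left_part[OF \<eta> u])
qed

lemma left_part_below_quantile:
  assumes \<eta>: "real_distribution \<eta>" and u: "0 < u" "u < 1"
    and A: "A \<in> sets borel" "A \<subseteq> {..<quantile \<eta> u}"
  shows "emeasure (left_part \<eta> u) A = emeasure \<eta> A"
proof -
  have "A \<inter> {..<quantile \<eta> u} = A" "quantile \<eta> u \<notin> A" using A by auto
  thus ?thesis using A by (simp add: emeasure_left_part[OF \<eta> u])
qed

section \<open>Endpoints of the support\<close>

text \<open>The complement of the support is the union of all open null sets; by the Lindelof property
  countably many of them suffice.\<close>

lemma emeasure_compl_supp:
  assumes "sets \<eta> = sets borel"
  shows "- supp \<eta> \<in> sets borel" "emeasure \<eta> (- supp \<eta>) = 0"
proof -
  let ?F = "{A. open A \<and> emeasure \<eta> A = 0}"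
  have eq: "- supp \<eta> = \<Union>?F"
    unfolding supp_def by (auto simp: not_gr_zero)
  obtain F' where F': "F' \<subseteq> ?F" "countable F'" "\<Union>F' = \<Union>?F"
    using Lindelof[of ?F] by auto
  show "- supp \<eta> \<in> sets borel"
    unfolding eq by (intro borel_open open_Union) auto
  have "(\<Union>A\<in>F'. A) \<in> null_sets \<eta>"
    using F' assms by (intro null_sets_UN') (auto intro!: null_setsI)
  thus "emeasure \<eta> (- supp \<eta>) = 0"
    using F'(3) eq by auto
qed

lemma emeasure_beyond_ends:
  assumes "sets \<eta> = sets borel"
  shows "emeasure \<eta> {x. ereal x < left_end \<eta>} = 0"
    and "emeasure \<eta> {x. right_end \<eta> < ereal x} = 0"
proof -
  have "left_end \<eta> \<le> ereal x \<and> ereal x \<le> right_end \<eta>" if "x \<in> supp \<eta>" for x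
    using that hull_inc[of x "supp \<eta>" convex] unfolding left_end_def right_end_def
    by (auto intro!: Inf_lower Sup_upper)
  hence "{x. ereal x < left_end \<eta>} \<subseteq> - supp \<eta>" "{x. right_end \<eta> < ereal x} \<subseteq> - supp \<eta>"
    by force+
  thus "emeasure \<eta> {x. ereal x < left_end \<eta>} = 0" "emeasure \<eta> {x. right_end \<eta> < ereal x} = 0"
    using emeasure_compl_supp[OF assms] emeasure_mono[of _ "- supp \<eta>" \<eta>] assms
    by (metis le_zero_eq)+
qed

text \<open>The left end of \<open>\<mu>\<close> is a real number: the support of \<open>\<mu>\<close> has a point, which bounds it from
  above, and the support of \<open>\<nu>\<close> has a point, which bounds it from below.\<close>

lemma separating_point:
  assumes \<mu>: "real_distribution \<mu>" and \<nu>: "real_distribution \<nu>"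
    and ends: "right_end \<nu> \<le> left_end \<mu>"
  obtains l where "left_end \<mu> = ereal l" "emeasure \<mu> {..<l} = 0" "emeasure \<nu> {l<..} = 0"
proof -
  interpret \<mu>: real_distribution \<mu> by fact
  interpret \<nu>: real_distribution \<nu> by fact
  have ne: "supp \<eta> \<noteq> {}" if "real_distribution \<eta>" for \<eta>
  proof
    interpret real_distribution \<eta> by fact
    assume "supp \<eta> = {}"
    thus False using emeasure_compl_supp(2)[of \<eta>] emeasure_space_1 by simp
  qed
  obtain x y where "x \<in> supp \<mu>" "y \<in> supp \<nu>" using ne \<mu> \<nu> by blast
  hence "left_end \<mu> \<le> ereal x" "ereal y \<le> right_end \<nu>"
    using hull_inc[of x "supp \<mu>" convex] hull_inc[of y "supp \<nu>" convex]
    unfolding left_end_def right_end_def by (auto intro!: Inf_lower Sup_upper)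
  then obtain l where l: "left_end \<mu> = ereal l"
    using ends by (cases "left_end \<mu>") auto
  have "{l<..} \<subseteq> {x. right_end \<nu> < ereal x}" using ends l
    by (auto intro: le_less_trans)
  moreover have "{x. right_end \<nu> < ereal x} \<in> sets \<nu>" by simp
  ultimately have "emeasure \<nu> {l<..} = 0"
    using emeasure_beyond_ends(2)[of \<nu>] emeasure_mono
    by (metis \<nu>.events_eq_borel le_zero_eq)
  moreover have "emeasure \<mu> {..<l} = 0"
    using emeasure_beyond_ends(1)[of \<mu>] l by (simp add: lessThan_def)
  ultimately show thesis using l that by blast
qed

section \<open>The convex-decreasing order\<close>

lemma convex_real_measurable:
  fixes f :: "real \<Rightarrow> real"
  assumes "convex_on UNIV f"
  shows "f \<in> borel_measurable borel"
  using assms by (intro borel_measurable_continuous_onI convex_on_continuous) auto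

text \<open>A convex function lies above a supporting line, and affine functions are integrable.\<close>

lemma nn_integral_neg_part_convex:
  assumes \<eta>: "\<eta> \<in> fin_moment" and f: "convex_on UNIV f"
  shows "(\<integral>\<^sup>+x. ennreal (- f x) \<partial>\<eta>) < \<infinity>"
proof -
  interpret finite_measure \<eta> using \<eta> by (simp add: fin_moment_def)
  obtain s where s: "\<And>y. f y \<ge> f 0 + s * (y - 0)"
    using convex_le_Inf_differential[OF f, of 0] by auto
  have int: "integrable \<eta> (\<lambda>x. \<bar>- (f 0 + s * x)\<bar>)"
    using \<eta> by (auto simp: fin_moment_def)
  have "(\<integral>\<^sup>+x. ennreal (- f x) \<partial>\<eta>) \<le> (\<integral>\<^sup>+x. ennreal \<bar>- (f 0 + s * x)\<bar> \<partial>\<eta>)"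
  proof (intro nn_integral_mono ennreal_leI)
    show "- f x \<le> \<bar>- (f 0 + s * x)\<bar>" for x using s[of x] by auto
  qed
  also have "\<dots> < \<infinity>"
    using int by (auto simp: integrable_iff_bounded)
  finally show ?thesis .
qed

lemma ext_integral_eq:
  assumes sets: "sets \<eta> = sets borel" and f: "f \<in> borel_measurable borel"
    and neg: "(\<integral>\<^sup>+x. ennreal (- f x) \<partial>\<eta>) < \<infinity>"
  shows "ext_integral \<eta> f = (if integrable \<eta> f then ereal (\<integral>x. f x \<partial>\<eta>) else \<infinity>)"
proof -
  note [measurable_cong] = sets
  have meas: "f \<in> borel_measurable \<eta>" using f by simp
  have fin: "enn2ereal x = ereal (enn2real x)" if "x < \<infinity>" for x
    using that by (cases x) auto
  show ?thesis
  proof (cases "(\<integral>\<^sup>+x. ennreal (f x) \<partial>\<eta>) = \<infinity>")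
    case True
    hence "\<not> integrable \<eta> f" by (auto simp: real_integrable_def)
    thus ?thesis using True neg by (simp add: ext_integral_def fin)
  next
    case False
    hence "(\<integral>\<^sup>+x. ennreal (f x) \<partial>\<eta>) < \<infinity>" by (simp add: less_top[symmetric])
    moreover from this neg have "integrable \<eta> f"
      using meas by (auto simp: real_integrable_def)
    ultimately show ?thesis
      using neg by (simp add: ext_integral_def real_lebesgue_integral_def fin)
  qed
qed

text \<open>If \<open>\<eta>\<close> and \<open>\<kappa>\<close> have the same mass, subtracting \<open>f q\<close> from a non-increasing \<open>f\<close> shifts
  both integrals by the same amount. The shifted function is positive only to the left of \<open>q\<close>,
  where \<open>\<kappa>\<close> is larger, and negative only to the right of \<open>q\<close>, where \<open>\<eta>\<close> is larger. Positive and
  negative parts therefore compare separately.\<close>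

lemma le_cd_crossing:
  assumes \<eta>: "\<eta> \<in> fin_moment" and \<kappa>: "\<kappa> \<in> fin_moment"
    and mass: "measure \<eta> UNIV = measure \<kappa> UNIV"
    and below: "\<And>A. A \<in> sets borel \<Longrightarrow> A \<subseteq> {..<q} \<Longrightarrow> emeasure \<eta> A \<le> emeasure \<kappa> A"
    and above: "\<And>A. A \<in> sets borel \<Longrightarrow> A \<subseteq> {q<..} \<Longrightarrow> emeasure \<kappa> A \<le> emeasure \<eta> A"
  shows "le_cd \<eta> \<kappa>"
  unfolding le_cd_def
proof (intro allI impI)
  fix f :: "real \<Rightarrow> real" assume "convex_on UNIV f \<and> antimono f"
  hence conv: "convex_on UNIV f" and anti: "antimono f" by auto
  interpret \<eta>: finite_measure \<eta> using \<eta> by (simp add: fin_moment_def)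
  interpret \<kappa>: finite_measure \<kappa> using \<kappa> by (simp add: fin_moment_def)
  have sets[measurable_cong]: "sets \<eta> = sets borel" "sets \<kappa> = sets borel"
    using \<eta> \<kappa> by (auto simp: fin_moment_def)
  have space: "space \<eta> = UNIV" "space \<kappa> = UNIV"
    using sets[THEN sets_eq_imp_space_eq] by auto
  have [measurable]: "f \<in> borel_measurable borel"
    using conv by (rule convex_real_measurable)
  define g where "g x = f x - f q" for x
  have [measurable]: "g \<in> borel_measurable borel" by (simp add: g_def[abs_def])
  have pos: "(\<integral>\<^sup>+x. ennreal (g x) \<partial>\<eta>) \<le> (\<integral>\<^sup>+x. ennreal (g x) \<partial>\<kappa>)"
    by (rule nn_integral_mono_measure_on[OF sets, where S = "{..<q}"])
       (use anti in \<open>auto intro!: below ennreal_neg simp: g_def antimono_def not_less\<close>)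
  have neg: "(\<integral>\<^sup>+x. ennreal (- g x) \<partial>\<kappa>) \<le> (\<integral>\<^sup>+x. ennreal (- g x) \<partial>\<eta>)"
    by (rule nn_integral_mono_measure_on[OF sets(2,1), where S = "{q<..}"])
       (use anti in \<open>auto intro!: above ennreal_neg simp: g_def antimono_def not_less\<close>)
  have ext: "ext_integral \<gamma> f = (if integrable \<gamma> f then ereal (\<integral>x. f x \<partial>\<gamma>) else \<infinity>)"
    if "\<gamma> \<in> fin_moment" for \<gamma>
    using that conv nn_integral_neg_part_convex
    by (intro ext_integral_eq) (auto simp: fin_moment_def)
  have gconv: "convex_on UNIV g"
    using convex_on_add[OF conv, of "\<lambda>_. - f q"] by (simp add: g_def[abs_def] convex_on_def algebra_simps flip: distrib_right)
  show "ext_integral \<eta> f \<le> ext_integral \<kappa> f"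
  proof (cases "integrable \<kappa> f")
    case True
    hence g\<kappa>: "integrable \<kappa> g" by (auto simp: g_def[abs_def])
    have g\<eta>: "integrable \<eta> g"
      using g\<kappa> pos nn_integral_neg_part_convex[OF \<eta> gconv]
      by (auto simp: real_integrable_def top_unique)
    hence f\<eta>: "integrable \<eta> f"
      using Bochner_Integration.integrable_add[OF g\<eta>, of "\<lambda>_. f q"] by (simp add: g_def)
    have "(\<integral>x. g x \<partial>\<eta>) \<le> (\<integral>x. g x \<partial>\<kappa>)"
      unfolding real_lebesgue_integral_def[OF g\<eta>] real_lebesgue_integral_def[OF g\<kappa>]
      using g\<kappa> g\<eta> pos neg
      by (intro diff_mono enn2real_mono) (auto simp: real_integrable_def less_top)
    hence "(\<integral>x. f x \<partial>\<eta>) \<le> (\<integral>x. f x \<partial>\<kappa>)"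
      using f\<eta> True mass by (simp add: g_def space)
    thus ?thesis using f\<eta> True \<eta> \<kappa> by (simp add: ext)
  qed (use \<kappa> in \<open>simp add: ext\<close>)
qed

lemma integrable_hinge:
  assumes "\<eta> \<in> fin_moment"
  shows "integrable \<eta> (\<lambda>x. max 0 (k - x))"
proof -
  interpret finite_measure \<eta> using assms by (simp add: fin_moment_def)
  show ?thesis using assms by (auto simp: fin_moment_def intro!: integrable_max)
qed

lemma hinge_convex:
  fixes a b t :: real
  assumes "0 \<le> t" "t \<le> 1"
  shows "max 0 ((1 - t) * a + t * b) \<le> (1 - t) * max 0 a + t * max 0 b"
  using assms by (intro max.boundedI add_mono mult_left_mono add_nonneg_nonneg mult_nonneg_nonneg) auto

lemma convex_on_hinge: "convex_on UNIV (\<lambda>x. max 0 (k - x) :: real)"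
proof (rule convex_onI)
  fix t x y :: real assume "0 < t" "t < 1"
  hence "max 0 ((1 - t) * (k - x) + t * (k - y)) \<le> (1 - t) * max 0 (k - x) + t * max 0 (k - y)"
    by (intro hinge_convex) auto
  moreover have "(1 - t) * (k - x) + t * (k - y) = k - ((1 - t) *\<^sub>R x + t *\<^sub>R y)"
    by (simp add: algebra_simps)
  ultimately show "max 0 (k - ((1 - t) *\<^sub>R x + t *\<^sub>R y)) \<le> (1 - t) * max 0 (k - x) + t * max 0 (k - y)"
    by simp
qed simp

lemma ext_integral_integrable:
  assumes \<eta>: "\<eta> \<in> fin_moment" and f: "convex_on UNIV f" "integrable \<eta> f"
  shows "ext_integral \<eta> f = ereal (\<integral>x. f x \<partial>\<eta>)"
  using ext_integral_eq[OF _ convex_real_measurable[OF f(1)] nn_integral_neg_part_convex[OF \<eta> f(1)]]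
    assms by (simp add: fin_moment_def)

lemma le_cd_put:
  assumes \<eta>: "\<eta> \<in> fin_moment" and \<kappa>: "\<kappa> \<in> fin_moment" and le: "le_cd \<eta> \<kappa>"
  shows "put \<eta> k \<le> put \<kappa> k"
proof -
  let ?f = "\<lambda>x. max 0 (k - x) :: real"
  have "antimono ?f" by (auto simp: antimono_def)
  hence "ext_integral \<eta> ?f \<le> ext_integral \<kappa> ?f"
    using le convex_on_hinge unfolding le_cd_def by blast
  thus ?thesis
    using ext_integral_integrable[OF \<eta> convex_on_hinge integrable_hinge[OF \<eta>]]
      ext_integral_integrable[OF \<kappa> convex_on_hinge integrable_hinge[OF \<kappa>]]
    by (simp add: put_def)
qed

text \<open>The constants 1 and \<open>-1\<close> are both convex and non-increasing.\<close>

lemma le_cd_mass: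
  assumes \<eta>: "\<eta> \<in> fin_moment" and \<kappa>: "\<kappa> \<in> fin_moment" and le: "le_cd \<eta> \<kappa>"
  shows "measure \<eta> UNIV = measure \<kappa> UNIV"
proof -
  interpret \<eta>: finite_measure \<eta> using \<eta> by (simp add: fin_moment_def)
  interpret \<kappa>: finite_measure \<kappa> using \<kappa> by (simp add: fin_moment_def)
  have space: "space \<eta> = UNIV" "space \<kappa> = UNIV"
    using \<eta> \<kappa> sets_eq_imp_space_eq[of _ "borel :: real measure"] by (auto simp: fin_moment_def)
  have "c * measure \<eta> UNIV \<le> c * measure \<kappa> UNIV" for c :: real
  proof -
    have conv: "convex_on UNIV (\<lambda>_::real. c)" by (simp add: convex_on_const)
    have "antimono (\<lambda>_::real. c)" by (auto simp: antimono_def)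
    hence "ext_integral \<eta> (\<lambda>_. c) \<le> ext_integral \<kappa> (\<lambda>_. c)"
      using le conv unfolding le_cd_def by blast
    thus ?thesis
      using ext_integral_integrable[OF \<eta> conv] ext_integral_integrable[OF \<kappa> conv]
      by (simp add: space mult.commute)
  qed
  from this[of 1] this[of "-1"] show ?thesis by simp
qed

text \<open>The difference quotients of \<open>k \<mapsto> max 0 (k - x)\<close> from the right are bounded by 1 and
  converge to the indicator of \<open>x \<le> k\<close>, so a put function determines its measure.\<close>

lemma put_right_derivative:
  assumes "\<eta> \<in> fin_moment"
  shows "(\<lambda>n. real (Suc n) * (put \<eta> (k + 1 / real (Suc n)) - put \<eta> k)) \<longlonglongrightarrow> measure \<eta> {..k}"
proof -
  interpret finite_measure \<eta> using assms by (simp add: fin_moment_def)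
  have sets[measurable_cong]: "sets \<eta> = sets borel" using assms by (simp add: fin_moment_def)
  have space: "space \<eta> = UNIV" using sets_eq_imp_space_eq[OF sets] by simp
  let ?s = "\<lambda>n x. real (Suc n) * (max 0 (k + 1 / real (Suc n) - x) - max 0 (k - x))"
  have "(\<lambda>n. \<integral>x. ?s n x \<partial>\<eta>) \<longlonglongrightarrow> (\<integral>x. indicator {..k} x \<partial>\<eta>)"
  proof (rule integral_dominated_convergence[where w = "\<lambda>_. 1"])
    show "AE x in \<eta>. (\<lambda>n. ?s n x) \<longlonglongrightarrow> indicator {..k} x"
    proof (intro AE_I2)
      fix x
      show "(\<lambda>n. ?s n x) \<longlonglongrightarrow> indicator {..k} x"
      proof (cases "x \<le> k")
        case True
        hence "max 0 (k + 1 / real (Suc n) - x) = 1 / real (Suc n) + max 0 (k - x)" for n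
          using add_increasing2[OF _ True, of "1 / real (Suc n)"] by (simp add: max_def del: of_nat_Suc)
        hence "?s n x = 1" for n
          by (simp del: of_nat_Suc)
        thus ?thesis using True by (auto simp del: of_nat_Suc)
      next
        case False
        have "(\<lambda>n. 1 / real (Suc n)) \<longlonglongrightarrow> 0"
          using LIMSEQ_inverse_real_of_nat by (simp add: inverse_eq_divide)
        hence "eventually (\<lambda>n. 1 / real (Suc n) < x - k) sequentially"
          using False by (intro order_tendstoD) auto
        hence "eventually (\<lambda>n. ?s n x = 0) sequentially"
          by eventually_elim (use False in auto)
        thus ?thesis using False by (simp add: tendsto_eventually)
      qed
    qed
    show "AE x in \<eta>. norm (?s n x) \<le> 1" for n
    proof (intro AE_I2)
      fix x
      have "\<bar>max 0 (k + e - x) - max 0 (k - x)\<bar> \<le> e" if "0 \<le> e" for e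
        using that by (auto simp: max_def)
      from this[of "1 / real (Suc n)"]
      have "\<bar>max 0 (k + 1 / real (Suc n) - x) - max 0 (k - x)\<bar> \<le> 1 / real (Suc n)"
        by simp
      hence "real (Suc n) * \<bar>max 0 (k + 1 / real (Suc n) - x) - max 0 (k - x)\<bar>
          \<le> real (Suc n) * (1 / real (Suc n))"
        by (rule mult_left_mono) simp
      thus "norm (?s n x) \<le> 1"
        by (simp only: real_norm_def abs_mult abs_of_nat) simp
    qed
  qed auto
  moreover have "(\<integral>x. ?s n x \<partial>\<eta>) = real (Suc n) * (put \<eta> (k + 1 / real (Suc n)) - put \<eta> k)" for n
    using integrable_hinge[OF assms] by (simp add: put_def del: of_nat_Suc)
  ultimately show ?thesis by (simp add: space del: of_nat_Suc)
qed

lemma le_cd_antisym: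
  assumes \<eta>: "\<eta> \<in> fin_moment" and \<kappa>: "\<kappa> \<in> fin_moment" and le: "le_cd \<eta> \<kappa>" "le_cd \<kappa> \<eta>"
  shows "\<eta> = \<kappa>"
proof (rule cdf_unique')
  have "put \<eta> k = put \<kappa> k" for k
    using le_cd_put[OF \<eta> \<kappa> le(1)] le_cd_put[OF \<kappa> \<eta> le(2)] by (rule antisym)
  hence "measure \<eta> {..k} = measure \<kappa> {..k}" for k
    using put_right_derivative[OF \<eta>, of k] put_right_derivative[OF \<kappa>, of k]
    by (auto intro: LIMSEQ_unique)
  thus "cdf \<eta> = cdf \<kappa>" by (simp add: fun_eq_iff cdf_def)
qed (use \<eta> \<kappa> in \<open>auto simp: fin_moment_def finite_borel_measure_def finite_borel_measure_axioms_def\<close>)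

section \<open>The convex minorant of a difference of put functions\<close>

text \<open>The payoff \<open>max 0 (k - x)\<close> vanishes for \<open>x \<ge> k\<close>, so \<open>put \<eta> k\<close> sees \<open>\<eta>\<close> only below \<open>k\<close>.\<close>

lemma put_mono_on:
  assumes \<eta>: "\<eta> \<in> fin_moment" and \<kappa>: "\<kappa> \<in> fin_moment"
    and le: "\<And>A. A \<in> sets borel \<Longrightarrow> A \<subseteq> {..<k} \<Longrightarrow> emeasure \<eta> A \<le> emeasure \<kappa> A"
  shows "put \<eta> k \<le> put \<kappa> k"
proof -
  have "(\<integral>\<^sup>+x. ennreal (max 0 (k - x)) \<partial>\<eta>) \<le> (\<integral>\<^sup>+x. ennreal (max 0 (k - x)) \<partial>\<kappa>)"
    using \<eta> \<kappa> by (intro nn_integral_mono_measure_on[where S = "{..<k}"] le)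
      (auto simp: fin_moment_def max_def)
  also have "(\<integral>\<^sup>+x. ennreal (max 0 (k - x)) \<partial>\<kappa>) = ennreal (put \<kappa> k)"
    unfolding put_def using integrable_hinge[OF \<kappa>] by (rule nn_integral_eq_integral) auto
  also have "(\<integral>\<^sup>+x. ennreal (max 0 (k - x)) \<partial>\<eta>) = ennreal (put \<eta> k)"
    unfolding put_def using integrable_hinge[OF \<eta>] by (rule nn_integral_eq_integral) auto
  finally have "ennreal (put \<eta> k) \<le> ennreal (put \<kappa> k)" .
  moreover have "0 \<le> put \<kappa> k" by (simp add: put_def)
  ultimately show ?thesis by simp
qed

lemma put_mono_measure:
  assumes "\<kappa> \<in> fin_moment" "sets \<eta> = sets borel" "\<eta> \<le> \<kappa>"
  shows "put \<eta> k \<le> put \<kappa> k"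
proof -
  have "sets \<eta> = sets \<kappa>" using assms by (simp add: fin_moment_def)
  thus ?thesis
    using put_mono_on[OF fin_moment_mono[OF assms] assms(1)] le_measureD3[OF assms(3)] by blast
qed

lemma put_eq_0:
  assumes "sets \<eta> = sets borel" "emeasure \<eta> {..<l} = 0" "k \<le> l"
  shows "put \<eta> k = 0"
proof -
  have "AE x in \<eta>. x \<notin> {..<l}"
    using assms by (intro AE_not_in null_setsI) auto
  hence "(\<integral>x. max 0 (k - x) \<partial>\<eta>) = (\<integral>x. 0 \<partial>\<eta>)"
    using assms by (intro integral_cong_AE) auto
  thus ?thesis by (simp add: put_def)
qed

lemma convex_on_put:
  assumes "\<eta> \<in> fin_moment"
  shows "convex_on UNIV (put \<eta>)"
proof (rule convex_onI)
  fix t k k' :: real assume t: "0 < t" "t < 1"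
  have "put \<eta> ((1 - t) *\<^sub>R k + t *\<^sub>R k') \<le> (\<integral>x. (1 - t) * max 0 (k - x) + t * max 0 (k' - x) \<partial>\<eta>)"
    unfolding put_def
  proof (intro integral_mono)
    fix x
    have eq: "(1 - t) *\<^sub>R k + t *\<^sub>R k' - x = (1 - t) * (k - x) + t * (k' - x)"
      by (simp add: algebra_simps)
    show "max 0 ((1 - t) *\<^sub>R k + t *\<^sub>R k' - x) \<le> (1 - t) * max 0 (k - x) + t * max 0 (k' - x)"
      unfolding eq using t by (intro hinge_convex) auto
  qed (use integrable_hinge[OF assms] in auto)
  thus "put \<eta> ((1 - t) *\<^sub>R k + t *\<^sub>R k') \<le> (1 - t) * put \<eta> k + t * put \<eta> k'"
    using integrable_hinge[OF assms] by (simp add: put_def)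
qed simp

lemma integral_affine:
  assumes "\<eta> \<in> fin_moment"
  shows "integrable \<eta> (\<lambda>x. k - x)"
    and "(\<integral>x. k - x \<partial>\<eta>) = measure \<eta> UNIV * k - (\<integral>x. x \<partial>\<eta>)"
proof -
  interpret finite_measure \<eta> using assms by (simp add: fin_moment_def)
  have "space \<eta> = UNIV"
    using assms sets_eq_imp_space_eq[of \<eta> "borel :: real measure"] by (simp add: fin_moment_def)
  thus "integrable \<eta> (\<lambda>x. k - x)" "(\<integral>x. k - x \<partial>\<eta>) = measure \<eta> UNIV * k - (\<integral>x. x \<partial>\<eta>)"
    using assms by (auto simp: fin_moment_def)
qed

lemma put_ge_affine:
  assumes "\<eta> \<in> fin_moment"
  shows "measure \<eta> UNIV * k - (\<integral>x. x \<partial>\<eta>) \<le> put \<eta> k"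
  unfolding put_def integral_affine(2)[OF assms, symmetric]
  using integral_affine(1)[OF assms] integrable_hinge[OF assms] by (intro integral_mono) auto

text \<open>The gap between \<open>max 0 (k - x)\<close> and \<open>k - x\<close> is the non-negative function \<open>max 0 (x - k)\<close>, so
  the integrals agree exactly when there is no mass to the right of \<open>k\<close>.\<close>

lemma put_eq_affine_iff:
  assumes \<eta>: "\<eta> \<in> fin_moment"
  shows "put \<eta> k = measure \<eta> UNIV * k - (\<integral>x. x \<partial>\<eta>) \<longleftrightarrow> emeasure \<eta> {k<..} = 0"
proof -
  note int = integral_affine(1)[OF \<eta>, of k] integrable_hinge[OF \<eta>, of k]
  have sets[measurable_cong]: "sets \<eta> = sets borel" using \<eta> by (simp add: fin_moment_def)
  have space: "space \<eta> = UNIV" using sets_eq_imp_space_eq[OF sets] by simp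
  have "put \<eta> k = measure \<eta> UNIV * k - (\<integral>x. x \<partial>\<eta>) \<longleftrightarrow> (\<integral>x. max 0 (k - x) - (k - x) \<partial>\<eta>) = 0"
    unfolding put_def integral_affine(2)[OF \<eta>, symmetric]
      Bochner_Integration.integral_diff[OF int(2,1)] by simp
  also have "\<dots> \<longleftrightarrow> (AE x in \<eta>. max 0 (k - x) - (k - x) = 0)"
    using int by (intro integral_nonneg_eq_0_iff_AE) auto
  also have "\<dots> \<longleftrightarrow> (AE x in \<eta>. \<not> k < x)"
    by (intro AE_cong) auto
  also have "\<dots> \<longleftrightarrow> emeasure \<eta> {k<..} = 0"
    using AE_iff_measurable[of "{k<..}" \<eta> "\<lambda>x. \<not> k < x"] by (auto simp: space greaterThan_def)
  finally show ?thesis .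
qed

lemma put_eq_affine:
  assumes \<eta>: "\<eta> \<in> fin_moment" and q: "emeasure \<eta> {q<..} = 0" "q \<le> k"
  shows "put \<eta> k = measure \<eta> UNIV * k - (\<integral>x. x \<partial>\<eta>)"
proof -
  have "emeasure \<eta> {k<..} \<le> emeasure \<eta> {q<..}"
    using \<eta> q by (intro emeasure_mono) (auto simp: fin_moment_def)
  thus ?thesis using put_eq_affine_iff[OF \<eta>] q by simp
qed

lemma put_le_affine:
  assumes \<eta>: "\<eta> \<in> fin_moment" and l: "emeasure \<eta> {..<l} = 0" "l \<le> k"
  shows "put \<eta> k \<le> measure \<eta> UNIV * (k - l)"
proof -
  interpret finite_measure \<eta> using \<eta> by (simp add: fin_moment_def)
  have sets: "sets \<eta> = sets borel" using \<eta> by (simp add: fin_moment_def)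
  have space: "space \<eta> = UNIV" using sets_eq_imp_space_eq[OF sets] by simp
  have "AE x in \<eta>. x \<notin> {..<l}"
    using l sets by (intro AE_not_in null_setsI) auto
  hence "put \<eta> k \<le> (\<integral>x. k - l \<partial>\<eta>)"
    unfolding put_def using integrable_hinge[OF \<eta>] l by (intro integral_mono_AE) auto
  thus ?thesis by (simp add: space)
qed

text \<open>Chord slopes of a convex function increase. A slope above \<open>s\<close> between \<open>q\<close> and \<open>k\<close> would
  persist to the right and eventually violate the affine bound.\<close>

lemma convex_bounded_growth:
  fixes g :: "real \<Rightarrow> real"
  assumes conv: "convex_on UNIV g" and bound: "\<And>x. l \<le> x \<Longrightarrow> g x \<le> s * x + c" and "q \<le> k"
  shows "g k \<le> g q + s * (k - q)"
proof (rule ccontr)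
  assume neg: "\<not> ?thesis"
  hence qk: "q < k" using \<open>q \<le> k\<close> by (cases "q = k") auto
  define s' where "s' = (g k - g q) / (k - q)"
  have s': "s < s'" using neg qk by (simp add: s'_def field_simps)
  have chord: "g q + s' * (x - q) \<le> g x" if "k < x" for x
    using convex_on_slope_le(1)[OF conv _ _ qk that] qk that
    by (simp add: s'_def field_simps)
  \<comment> \<open>Far enough to the right that the chord of slope \<open>s'\<close> has overtaken the affine bound.\<close>
  define x where "x = Max {l, k + 1, (c - g q + s' * q) / (s' - s) + 1}"
  have x: "l \<le> x" "k < x" "(c - g q + s' * q) / (s' - s) < x"
    by (auto simp: x_def less_max_iff_disj)
  hence "g q + s' * (x - q) \<le> s * x + c"
    using chord bound by (meson order_trans)
  moreover have "c - g q + s' * q < x * (s' - s)"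
    using x(3) s' by (simp add: pos_divide_less_eq)
  ultimately show False by (simp add: algebra_simps)
qed

text \<open>Up to \<open>l\<close>, where \<open>put \<alpha>\<close> vanishes, \<open>put \<kappa>\<close> is a minorant because \<open>\<kappa> \<le> \<nu>\<close>. Beyond \<open>l\<close>, the
  function \<open>put \<kappa>\<close> grows at the rate \<open>measure \<kappa> UNIV\<close>, and \<open>put \<nu> - put \<alpha>\<close> grows from \<open>l\<close> on
  average at least as fast, since \<open>put \<nu>\<close> has slope \<open>measure \<nu> UNIV\<close> there and \<open>put \<alpha>\<close> has slope
  at most \<open>measure \<alpha> UNIV\<close>. Maximality holds up to \<open>q\<close> because there \<open>put \<kappa>\<close> equals the given
  function, and after \<open>q\<close> because the asymptotic slope bounds the growth of any convex
  minorant.\<close>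

lemma convex_minorant_put_diff:
  assumes \<kappa>: "\<kappa> \<in> fin_moment" and \<nu>: "\<nu> \<in> fin_moment" and \<alpha>: "\<alpha> \<in> fin_moment"
    and mass: "measure \<nu> UNIV = measure \<kappa> UNIV + measure \<alpha> UNIV"
    and le: "\<kappa> \<le> \<nu>"
    and eq: "\<And>A. A \<in> sets borel \<Longrightarrow> A \<subseteq> {..<q} \<Longrightarrow> emeasure \<kappa> A = emeasure \<nu> A"
    and q: "emeasure \<kappa> {q<..} = 0" "q \<le> l"
    and l: "emeasure \<nu> {l<..} = 0" "emeasure \<alpha> {..<l} = 0"
  shows "convex_minorant (\<lambda>k. put \<nu> k - put \<alpha> k) = put \<kappa>"
  unfolding convex_minorant_def
proof (intro Greatest_equality conjI)
  let ?E = "\<lambda>k. put \<nu> k - put \<alpha> k"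
  have \<alpha>0: "put \<alpha> k = 0" if "k \<le> l" for k
    using \<alpha> l that by (intro put_eq_0) (auto simp: fin_moment_def)
  show "convex_on UNIV (put \<kappa>)" using \<kappa> by (rule convex_on_put)
  show "put \<kappa> \<le> ?E"
  proof (intro le_funI)
    fix k
    have le': "put \<kappa> k \<le> put \<nu> k" for k
      using \<kappa> \<nu> le by (intro put_mono_measure) (auto simp: fin_moment_def)
    show "put \<kappa> k \<le> put \<nu> k - put \<alpha> k"
    proof (cases "k \<le> l")
      case True
      thus ?thesis using \<alpha>0 le' by simp
    next
      case False
      hence k: "l \<le> k" by simp
      have "put \<kappa> k = put \<kappa> l + measure \<kappa> UNIV * (k - l)"
        using put_eq_affine[OF \<kappa> q(1), of k] put_eq_affine[OF \<kappa> q] q(2) k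
        by (simp add: algebra_simps)
      also have "\<dots> \<le> put \<nu> l + measure \<kappa> UNIV * (k - l)" using le' by simp
      also have "\<dots> = put \<nu> k - measure \<alpha> UNIV * (k - l)"
        using put_eq_affine[OF \<nu> l(1), of k] put_eq_affine[OF \<nu> l(1), of l] k mass
        by (simp add: algebra_simps)
      also have "\<dots> \<le> put \<nu> k - put \<alpha> k"
        using put_le_affine[OF \<alpha> l(2) k] by simp
      finally show ?thesis .
    qed
  qed
  fix g assume g: "convex_on UNIV g \<and> g \<le> ?E"
  have below: "g k \<le> put \<kappa> k" if "k \<le> q" for k
  proof -
    have "put \<nu> k \<le> put \<kappa> k"
      using that by (intro put_mono_on \<kappa> \<nu>) (metis eq order_refl lessThan_subset_iff order_trans)
    moreover have "g k \<le> put \<nu> k"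
      using g \<alpha>0[of k] that q(2) by (auto simp: le_fun_def dest: spec[of _ k])
    ultimately show ?thesis by simp
  qed
  show "g \<le> put \<kappa>"
  proof (intro le_funI)
    fix k
    show "g k \<le> put \<kappa> k"
    proof (cases "k \<le> q")
      case False
      hence k: "q \<le> k" by simp
      have "g x \<le> measure \<kappa> UNIV * x + ((\<integral>y. y \<partial>\<alpha>) - (\<integral>y. y \<partial>\<nu>))" if "l \<le> x" for x
        using g put_eq_affine[OF \<nu> l(1) that] put_ge_affine[OF \<alpha>, of x] mass
        by (auto simp: le_fun_def algebra_simps dest!: spec[of _ x])
      hence "g k \<le> g q + measure \<kappa> UNIV * (k - q)"
        using g k by (intro convex_bounded_growth) auto
      also have "\<dots> \<le> put \<kappa> q + measure \<kappa> UNIV * (k - q)" using below by simp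
      also have "\<dots> = put \<kappa> k"
        using put_eq_affine[OF \<kappa> q(1), of k] put_eq_affine[OF \<kappa> q(1), of q] k
        by (simp add: algebra_simps)
      finally show ?thesis .
    qed (fact below)
  qed
qed

text \<open>To the right of \<open>q\<close> the function \<open>put \<kappa>\<close> is affine with slope \<open>measure \<kappa> UNIV\<close>. This slope
  supports it everywhere, and testing a subgradient at \<open>q\<close> shows that none is smaller.\<close>

lemma Inf_subdiff_put:
  assumes \<kappa>: "\<kappa> \<in> fin_moment" and q: "emeasure \<kappa> {q<..} = 0" "q < x"
  shows "Inf (subdiff (put \<kappa>) x) = measure \<kappa> UNIV"
proof (rule cInf_eq_minimum)
  have at: "put \<kappa> k = measure \<kappa> UNIV * k - (\<integral>x. x \<partial>\<kappa>)" if "q \<le> k" for k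
    using \<kappa> q(1) that by (rule put_eq_affine)
  have "put \<kappa> x + measure \<kappa> UNIV * (y - x) \<le> put \<kappa> y" for y
    using put_ge_affine[OF \<kappa>, of y] at[of x] q(2) by (simp add: algebra_simps)
  thus "measure \<kappa> UNIV \<in> subdiff (put \<kappa>) x" by (simp add: subdiff_def)
  fix s assume "s \<in> subdiff (put \<kappa>) x"
  hence "put \<kappa> x + s * (q - x) \<le> put \<kappa> q" by (simp add: subdiff_def)
  hence "measure \<kappa> UNIV * (x - q) \<le> s * (x - q)"
    using at[of x] at[of q] q(2) by (simp add: algebra_simps)
  thus "measure \<kappa> UNIV \<le> s" using q(2) by simp
qed

section \<open>The lower function for separated marginals\<close>

lemma atMost_Un_greaterThan: "{..k} \<union> {k<..} = (UNIV :: real set)"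
  by auto

text \<open>The point \<open>q = quantile \<nu> (1 - u)\<close> lies on the supporting line because the left part of \<open>\<nu>\<close>
  has no mass beyond it. An earlier point \<open>k\<close> would lie on the line only if the left part had no
  mass beyond \<open>k\<close>, but its mass is \<open>1 - u\<close> and less than that lies up to \<open>k\<close>.\<close>

lemma R_fun_eq_quantile:
  assumes \<mu>: "real_distribution \<mu>" "\<mu> \<in> fin_moment"
    and \<nu>: "real_distribution \<nu>" "\<nu> \<in> fin_moment"
    and l: "emeasure \<mu> {..<l} = 0" "emeasure \<nu> {l<..} = 0"
    and u: "0 < u" "u < 1"
    and ql: "quantile \<nu> (1 - u) \<le> l" and less: "quantile \<nu> (1 - u) < quantile \<mu> u"
  shows "R_fun \<mu> \<nu> u = quantile \<nu> (1 - u)"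
proof -
  interpret \<nu>: real_distribution \<nu> by fact
  define q where "q = quantile \<nu> (1 - u)"
  define G where "G = quantile \<mu> u"
  define \<alpha> where "\<alpha> = left_part \<mu> u"
  define \<kappa> where "\<kappa> = left_part \<nu> (1 - u)"
  have v: "0 < 1 - u" "1 - u < 1" using u by auto
  have sets: "sets \<mu> = sets borel" "sets \<alpha> = sets borel" "sets \<kappa> = sets borel"
    using \<mu> by (simp_all add: \<alpha>_def \<kappa>_def fin_moment_def)
  have \<alpha>le: "\<alpha> \<le> \<mu>" unfolding \<alpha>_def using \<mu>(1) u by (rule left_part_le)
  have \<kappa>le: "\<kappa> \<le> \<nu>" unfolding \<kappa>_def using \<nu>(1) v by (rule left_part_le)
  have \<alpha>: "\<alpha> \<in> fin_moment" using \<mu>(2) sets(2) \<alpha>le by (rule fin_moment_mono)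
  have \<kappa>: "\<kappa> \<in> fin_moment" using \<nu>(2) sets(3) \<kappa>le by (rule fin_moment_mono)
  have mass\<kappa>: "measure \<kappa> UNIV = 1 - u" unfolding \<kappa>_def using \<nu>(1) v by (rule measure_left_part)
  have \<alpha>l: "emeasure \<alpha> {..<l} = 0"
    using le_measureD3[OF \<alpha>le, of "{..<l}"] sets l(1) by simp
  have \<kappa>q: "emeasure \<kappa> {q<..} = 0"
    unfolding \<kappa>_def q_def using \<nu>(1) v by (rule left_part_above_quantile)
  have \<kappa>eq: "emeasure \<kappa> A = emeasure \<nu> A" if "A \<in> sets borel" "A \<subseteq> {..<q}" for A
    using left_part_below_quantile[OF \<nu>(1) v] that by (simp add: \<kappa>_def q_def)
  have hull: "convex_minorant (E_fun \<mu> \<nu> u) = put \<kappa>"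
    unfolding E_fun_def[abs_def] \<alpha>_def[symmetric]
  proof (rule convex_minorant_put_diff[OF \<kappa> \<nu>(2) \<alpha> _ \<kappa>le \<kappa>eq \<kappa>q _ l(2) \<alpha>l])
    show "measure \<nu> UNIV = measure \<kappa> UNIV + measure \<alpha> UNIV"
      using \<nu>.prob_space mass\<kappa> measure_left_part[OF \<mu>(1) u] by (simp add: \<alpha>_def)
  qed (use ql in \<open>auto simp: q_def\<close>)
  have phi: "phi_fun \<mu> \<nu> u = 1 - u"
    unfolding phi_fun_def hull
    using Inf_subdiff_put[OF \<kappa> \<kappa>q] less mass\<kappa> by (simp add: q_def)
  have tangent: "put \<kappa> G + (1 - u) * (k - G) = measure \<kappa> UNIV * k - (\<integral>x. x \<partial>\<kappa>)" for k
    using less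
    by (subst put_eq_affine[OF \<kappa> \<kappa>q]) (auto simp: mass\<kappa> q_def G_def algebra_simps)
  have D: "D_fun \<mu> \<nu> k = put \<kappa> k" if "k \<le> q" for k
  proof -
    have "put \<mu> k = 0"
      using sets(1) l(1) by (rule put_eq_0) (use that ql in \<open>simp add: q_def\<close>)
    moreover have "put \<nu> k \<le> put \<kappa> k"
      using that by (intro put_mono_on \<nu>(2) \<kappa>) (metis \<kappa>eq order_refl lessThan_subset_iff order_trans)
    moreover have "put \<kappa> k \<le> put \<nu> k"
      using \<nu>(2) sets(3) \<kappa>le by (rule put_mono_measure)
    ultimately show ?thesis by (simp add: D_fun_def)
  qed
  have "Inf {k. k \<le> G \<and> D_fun \<mu> \<nu> k = measure \<kappa> UNIV * k - (\<integral>x. x \<partial>\<kappa>)} = q"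
  proof (rule cInf_eq_minimum)
    show "q \<in> {k. k \<le> G \<and> D_fun \<mu> \<nu> k = measure \<kappa> UNIV * k - (\<integral>x. x \<partial>\<kappa>)}"
      using less D[of q] put_eq_affine[OF \<kappa> \<kappa>q, of q] by (simp add: q_def G_def)
    fix k assume k: "k \<in> {k. k \<le> G \<and> D_fun \<mu> \<nu> k = measure \<kappa> UNIV * k - (\<integral>x. x \<partial>\<kappa>)}"
    show "q \<le> k"
    proof (rule ccontr)
      assume "\<not> q \<le> k"
      hence kq: "k < q" by simp
      hence "emeasure \<kappa> {k<..} = 0"
        using k D[of k] put_eq_affine_iff[OF \<kappa>, of k] by simp
      have "measure \<kappa> UNIV \<le> measure \<kappa> {..k} + measure \<kappa> {k<..}"
        using measure_Un_le[of "{..k}" \<kappa> "{k<..}"] atMost_Un_greaterThan[of k]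
        by (simp add: sets)
      also have "measure \<kappa> {k<..} = 0" using \<open>emeasure \<kappa> {k<..} = 0\<close> by (simp add: measure_def)
      also have "measure \<kappa> {..k} = measure \<nu> {..k}"
        using \<kappa>eq[of "{..k}"] kq by (simp add: measure_def subset_eq)
      also have "\<dots> < 1 - u"
        using quantile_le_iff[OF \<nu>(1) v, of k] kq by (simp add: q_def)
      finally show False using mass\<kappa> by simp
    qed
  qed
  thus ?thesis
    unfolding R_fun_def hull phi G_def[symmetric] tangent q_def .
qed

text \<open>If the two quantiles met, they would both be \<open>l\<close>. Then \<open>\<mu>\<close> would reach mass \<open>u\<close> at \<open>l\<close>
  having none before, and \<open>\<nu>\<close> would have at most \<open>1 - u\<close> before \<open>l\<close> and none after, so that both
  would have an atom of mass at least \<open>u\<close> at \<open>l\<close>.\<close>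

lemma quantiles_separated:
  assumes \<mu>: "real_distribution \<mu>" and \<nu>: "real_distribution \<nu>"
    and l: "emeasure \<mu> {..<l} = 0" "emeasure \<nu> {l<..} = 0"
    and atom: "measure \<mu> {l} = 0 \<or> measure \<nu> {l} = 0"
    and u: "0 < u" "u < 1"
  shows "quantile \<nu> (1 - u) \<le> l" "l \<le> quantile \<mu> u" "quantile \<nu> (1 - u) < quantile \<mu> u"
proof -
  interpret \<mu>: real_distribution \<mu> by fact
  interpret \<nu>: real_distribution \<nu> by fact
  have v: "0 < 1 - u" "1 - u < 1" using u by auto
  have "measure \<nu> UNIV \<le> measure \<nu> {..l} + measure \<nu> {l<..}"
    using measure_Un_le[of "{..l}" \<nu> "{l<..}"] atMost_Un_greaterThan[of l] by simp
  hence \<nu>l: "1 \<le> measure \<nu> {..l}" using l(2) \<nu>.prob_space by (simp add: measure_def)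
  thus 1: "quantile \<nu> (1 - u) \<le> l" using quantile_le_iff[OF \<nu> v] u by simp
  have \<mu>l: "measure \<mu> {..k} \<le> measure \<mu> {..<l}" if "k < l" for k
    using that by (intro \<mu>.finite_measure_mono) auto
  show 2: "l \<le> quantile \<mu> u"
  proof (rule ccontr)
    assume "\<not> ?thesis"
    hence "u \<le> measure \<mu> {..<l}"
      using \<mu>l[of "quantile \<mu> u"] quantile_le_iff[OF \<mu> u, of "quantile \<mu> u"] by simp
    thus False using l(1) u by (simp add: measure_def)
  qed
  show "quantile \<nu> (1 - u) < quantile \<mu> u"
  proof (rule ccontr)
    assume "\<not> ?thesis"
    hence eq: "quantile \<nu> (1 - u) = l" "quantile \<mu> u = l" using 1 2 by auto
    have "u \<le> measure \<mu> {l}"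
      using quantile_between(2)[OF \<mu> u] eq l(1) by (simp add: measure_def)
    moreover have "u \<le> measure \<nu> {l}"
      using quantile_between(1)[OF \<nu> v] measure_atMost_eq[OF \<nu>, of l] eq \<nu>l by simp
    ultimately show False using atom u by auto
  qed
qed

section \<open>Shadows below a separating point\<close>

text \<open>Here \<open>\<theta>\<close> is the part of \<open>\<nu>\<close> that lies above \<open>q\<close>, possibly with some of the mass at \<open>q\<close>.
  The comparison with \<open>\<eta>\<close> crosses at \<open>l\<close>, where \<open>\<theta>\<close> ends and \<open>\<eta>\<close> begins. The comparison with
  another candidate \<open>\<theta>'\<close> crosses at \<open>q\<close>: above \<open>q\<close> the candidate is at most \<open>\<nu>\<close>, which \<open>\<theta>\<close>
  exhausts there, and below \<open>q\<close> there is nothing left of \<open>\<theta>\<close>.\<close>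

lemma is_shadow_upper_part:
  assumes \<eta>: "\<eta> \<in> fin_moment" and \<theta>: "\<theta> \<in> fin_moment" and \<nu>: "\<nu> \<in> fin_moment"
    and mass: "measure \<eta> UNIV = measure \<theta> UNIV" and le: "\<theta> \<le> \<nu>"
    and l: "emeasure \<eta> {..<l} = 0" "emeasure \<nu> {l<..} = 0"
    and below: "emeasure \<theta> {..<q} = 0"
    and above: "\<And>A. A \<in> sets borel \<Longrightarrow> A \<subseteq> {q<..} \<Longrightarrow> emeasure \<nu> A \<le> emeasure \<theta> A"
  shows "is_shadow \<nu> \<eta> \<theta>"
proof -
  have sets: "sets \<eta> = sets borel" "sets \<theta> = sets borel" "sets \<nu> = sets borel"
    using \<eta> \<theta> \<nu> by (auto simp: fin_moment_def)
  have sub: "emeasure \<gamma> A = 0"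
    if "emeasure \<gamma> B = 0" "A \<subseteq> B" "B \<in> sets borel" "sets \<gamma> = sets borel" for \<gamma> and A B :: "real set"
    using that emeasure_mono[of A B \<gamma>] by auto
  have \<theta>l: "emeasure \<theta> {l<..} = 0"
    using le_measureD3[OF le, of "{l<..}"] sets l(2) by simp
  have 1: "le_cd \<eta> \<theta>"
    using \<eta> \<theta> mass
  proof (rule le_cd_crossing)
    show "emeasure \<eta> A \<le> emeasure \<theta> A" if "A \<subseteq> {..<l}" for A
      using sub[OF l(1) that] sets by simp
    show "emeasure \<theta> A \<le> emeasure \<eta> A" if "A \<subseteq> {l<..}" for A
      using sub[OF \<theta>l that] sets by simp
  qed
  have 2: "le_cd \<theta> \<theta>'" if \<theta>': "\<theta>' \<in> fin_moment" "le_cd \<eta> \<theta>'" "\<theta>' \<le> \<nu>" for \<theta>'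
    using \<theta> \<theta>'(1)
  proof (rule le_cd_crossing)
    have sets': "sets \<theta>' = sets \<nu>" using \<theta>'(1) sets(3) by (simp add: fin_moment_def)
    show "measure \<theta> UNIV = measure \<theta>' UNIV"
      using le_cd_mass[OF \<eta> \<theta>'(1,2)] mass by simp
    show "emeasure \<theta> A \<le> emeasure \<theta>' A" if "A \<subseteq> {..<q}" for A
      using sub[OF below that] sets by simp
    show "emeasure \<theta>' A \<le> emeasure \<theta> A" if "A \<in> sets borel" "A \<subseteq> {q<..}" for A
      using le_measureD3[OF \<theta>'(3) sets', of A] above[OF that] by simp
  qed
  show ?thesis
    unfolding is_shadow_def using \<theta> 1 2 le by blast
qed

lemma shadow_eqI:
  assumes "is_shadow \<nu> \<eta> \<theta>"
  shows "shadow \<nu> \<eta> = \<theta>"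
  unfolding shadow_def
proof (rule the_equality)
  show "is_shadow \<nu> \<eta> \<theta>" by fact
  fix \<theta>' assume "is_shadow \<nu> \<eta> \<theta>'"
  thus "\<theta>' = \<theta>"
    using assms unfolding is_shadow_def by (intro le_cd_antisym) auto
qed

section \<open>The coupling\<close>

text \<open>As \<open>Y\<close> is already measurable for the first \<open>\<sigma>\<close>-algebra, it is its own conditional
  expectation.\<close>

lemma (in prob_space) two_step_supermartingaleI:
  assumes U: "U \<in> borel_measurable M" and V: "V \<in> borel_measurable M"
    and X: "X \<in> borel_measurable (vimage_algebra (space M) U borel)" "integrable M X"
    and Y: "Y \<in> borel_measurable (vimage_algebra (space M) U borel)" "integrable M Y"
    and le: "\<And>w. w \<in> space M \<Longrightarrow> Y w \<le> X w"
  shows "two_step_supermartingale M (vimage_algebra (space M) U borel)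
    (vimage_algebra (space M) (\<lambda>w. (U w, V w)) (borel \<Otimes>\<^sub>M borel)) X Y"
proof -
  let ?F1 = "vimage_algebra (space M) U borel"
  let ?F2 = "vimage_algebra (space M) (\<lambda>w. (U w, V w)) (borel \<Otimes>\<^sub>M borel)"
  note [measurable] = U V
  have "(\<lambda>w. (U w, V w)) \<in> M \<rightarrow>\<^sub>M borel \<Otimes>\<^sub>M borel" by measurable
  hence F2: "subalgebra M ?F2"
    by (simp add: subalgebra_def measurable_iff_sets)
  have "(\<lambda>w. (U w, V w)) \<in> ?F2 \<rightarrow>\<^sub>M borel \<Otimes>\<^sub>M borel"
    by (rule measurable_vimage_algebra1) (auto simp: space_pair_measure)
  hence "(\<lambda>w. fst (U w, V w)) \<in> borel_measurable ?F2"
    by (rule measurable_compose[OF _ measurable_fst])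
  hence F12: "subalgebra ?F2 ?F1"
    by (simp add: subalgebra_def measurable_iff_sets)
  interpret finite_measure_subalgebra M ?F1
    by standard (use U in \<open>simp add: subalgebra_def measurable_iff_sets\<close>)
  have "AE w in M. real_cond_exp M ?F1 Y w \<le> X w"
    using real_cond_exp_F_meas[OF Y(2,1)] AE_space by eventually_elim (use le in auto)
  thus ?thesis
    unfolding two_step_supermartingale_def
    using F2 F12 X Y measurable_from_subalg[OF F12 Y(1)] by simp
qed

lemma (in prob_space) uniform_distr_probs:
  assumes U: "U \<in> borel_measurable M"
    and unif: "distr M borel U = uniform_measure lborel {0<..<1}"
    and a: "0 \<le> a" "a \<le> 1"
  shows "prob {w \<in> space M. U w \<le> a} = a" "prob {w \<in> space M. 1 - U w \<le> a} = a"
proof -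
  have A: "prob {w \<in> space M. U w \<in> A} = measure lborel ({0<..<1} \<inter> A)" if A: "A \<in> sets borel" for A
  proof -
    have "prob {w \<in> space M. U w \<in> A} = measure (distr M borel U) A"
      using U A by (auto simp: measure_distr intro!: arg_cong[where f=prob])
    also have "\<dots> = measure lborel ({0<..<1} \<inter> A)"
      using A by (simp add: unif measure_uniform_measure)
    finally show ?thesis .
  qed
  have "measure lborel ({0<..<1} \<inter> {..a}) = measure lborel {0<..a}" if "a < 1"
    using that by (intro arg_cong[where f="measure lborel"]) auto
  moreover have "{0<..<1} \<inter> {..a} = {0<..<1}" if "\<not> a < 1" using that a by auto
  ultimately have 1: "measure lborel ({0<..<1} \<inter> {..a}) = a"
    using a by (cases "a < 1") auto
  have "measure lborel ({0<..<1} \<inter> {1 - a..}) = measure lborel {1 - a..<1}" if "a < 1"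
    using that by (intro arg_cong[where f="measure lborel"]) auto
  moreover have "{0<..<1} \<inter> {1 - a..} = {0<..<1}" if "\<not> a < 1" using that a by auto
  ultimately have 2: "measure lborel ({0<..<1} \<inter> {1 - a..}) = a"
    using a by (cases "a < 1") auto
  show "prob {w \<in> space M. U w \<le> a} = a"
    using A[of "{..a}"] 1 by simp
  have "{w \<in> space M. 1 - U w \<le> a} = {w \<in> space M. U w \<in> {1 - a..}}" by auto
  thus "prob {w \<in> space M. 1 - U w \<le> a} = a"
    using A[of "{1 - a..}"] 2 by simp
qed

text \<open>The candidate for the shadow is defined on the probability space, as the law of \<open>Y\<close> under
  the restriction of \<open>M\<close> to the event \<open>U \<le> u\<close>; it is then below the law \<open>\<nu>\<close> of \<open>Y\<close> by
  construction. It is the upper part of \<open>\<nu>\<close> because \<open>Y\<close> decreases in \<open>U\<close>: the event \<open>U \<le> u\<close> contains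
  \<open>Y > q\<close> and is disjoint from \<open>Y < q\<close> for \<open>q = quantile \<nu> (1 - u)\<close>.\<close>

lemma (in prob_space) shadow_left_part_eq_restricted_law:
  assumes \<mu>: "real_distribution \<mu>" "\<mu> \<in> fin_moment"
    and \<nu>: "real_distribution \<nu>" "\<nu> \<in> fin_moment"
    and l: "emeasure \<mu> {..<l} = 0" "emeasure \<nu> {l<..} = 0"
    and U: "U \<in> borel_measurable M" and range: "\<And>w. w \<in> space M \<Longrightarrow> U w \<in> {0<..<1}"
    and probU: "prob {w \<in> space M. U w \<le> u} = u"
    and Y: "Y \<in> borel_measurable M" "\<And>w. w \<in> space M \<Longrightarrow> Y w = quantile \<nu> (1 - U w)"
    and law: "distr M borel Y = \<nu>"
    and u: "0 < u" "u < 1" and B: "B \<in> sets borel"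
  shows "measure (shadow \<nu> (left_part \<mu> u)) B = prob {w \<in> space M. U w \<le> u \<and> Y w \<in> B}"
proof -
  note [measurable] = U Y(1)
  define W where "W = {w \<in> space M. U w \<le> u}"
  have [measurable]: "W \<in> sets M" unfolding W_def by measurable
  define \<theta> where "\<theta> = distr (density M (indicator W)) borel Y"
  have \<theta>: "emeasure \<theta> A = emeasure M {w \<in> space M. U w \<le> u \<and> Y w \<in> A}" if [measurable]: "A \<in> sets borel" for A
  proof -
    have "emeasure \<theta> A = (\<integral>\<^sup>+w. indicator W w * indicator (Y -` A \<inter> space M) w \<partial>M)"
      unfolding \<theta>_def by (subst emeasure_distr) (auto simp: emeasure_density)
    also have "\<dots> = (\<integral>\<^sup>+w. indicator {w \<in> space M. U w \<le> u \<and> Y w \<in> A} w \<partial>M)"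
      by (intro nn_integral_cong) (auto simp: W_def split: split_indicator)
    also have "\<dots> = emeasure M {w \<in> space M. U w \<le> u \<and> Y w \<in> A}"
      by (intro nn_integral_indicator) measurable
    finally show ?thesis .
  qed
  have \<nu>_eq: "emeasure \<nu> A = emeasure M {w \<in> space M. Y w \<in> A}" if "A \<in> sets borel" for A
    using that unfolding law[symmetric]
    by (auto simp: emeasure_distr intro!: arg_cong[where f="emeasure M"])
  have sets: "sets \<theta> = sets borel" "sets \<nu> = sets borel" "sets \<mu> = sets borel"
    using \<mu> \<nu> by (auto simp: \<theta>_def fin_moment_def)
  have le: "\<theta> \<le> \<nu>"
    by (subst le_measure) (auto simp: sets \<theta> \<nu>_eq intro!: emeasure_mono)
  have \<theta>fin: "\<theta> \<in> fin_moment" using \<nu>(2) sets(1) le by (rule fin_moment_mono)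
  have \<alpha>le: "left_part \<mu> u \<le> \<mu>" using \<mu>(1) u by (rule left_part_le)
  have \<alpha>: "left_part \<mu> u \<in> fin_moment"
    using \<mu>(2) _ \<alpha>le by (rule fin_moment_mono) simp
  have \<alpha>l: "emeasure (left_part \<mu> u) {..<l} = 0"
    using le_measureD3[OF \<alpha>le, of "{..<l}"] sets l(1) by simp
  define q where "q = quantile \<nu> (1 - u)"
  have v: "0 < 1 - u" "1 - u < 1" using u by auto
  have Yq: "Y w \<ge> q" if "w \<in> space M" "U w \<le> u" for w
    using that range[OF that(1)] u quantile_mono[OF \<nu>(1), of "1 - u" "1 - U w"] Y(2)
    by (simp add: q_def)
  have Uu: "U w \<le> u" if "w \<in> space M" "Y w > q" for w
    using that range[OF that(1)] u quantile_mono[OF \<nu>(1), of "1 - U w" "1 - u"] Y(2)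
    by (force simp: q_def)
  have "is_shadow \<nu> (left_part \<mu> u) \<theta>"
  proof (rule is_shadow_upper_part[OF \<alpha> \<theta>fin \<nu>(2) _ le \<alpha>l l(2)])
    show "measure (left_part \<mu> u) UNIV = measure \<theta> UNIV"
      using measure_left_part[OF \<mu>(1) u] \<theta>[of UNIV] probU by (simp add: measure_def)
    have "emeasure \<theta> {..<q} = emeasure M {w \<in> space M. U w \<le> u \<and> Y w \<in> {..<q}}"
      by (rule \<theta>) simp
    also have "{w \<in> space M. U w \<le> u \<and> Y w \<in> {..<q}} = {}" using Yq by force
    finally show "emeasure \<theta> {..<q} = 0" by simp
    fix A :: "real set" assume "A \<in> sets borel" "A \<subseteq> {q<..}"
    thus "emeasure \<nu> A \<le> emeasure \<theta> A"
      using Uu by (simp add: \<theta> \<nu>_eq) (intro emeasure_mono, auto)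
  qed
  hence "shadow \<nu> (left_part \<mu> u) = \<theta>" by (rule shadow_eqI)
  thus ?thesis using \<theta>[OF B] by (simp add: measure_def)
qed

theorem theorem4p2:
  fixes \<mu> \<nu> :: "real measure" and M :: "'w measure" and U V X Y :: "'w \<Rightarrow> real"
    and T :: "real \<Rightarrow> real"
  assumes mu: "\<mu> \<in> prob_fin_moment" and nu: "\<nu> \<in> prob_fin_moment"
    and ends: "right_end \<nu> \<le> left_end \<mu>"
    and no_common_atom:
      "min (measure \<mu> {x. ereal x = left_end \<mu>}) (measure \<nu> {x. ereal x = left_end \<mu>}) = 0"
    and prob: "prob_space M"
    and U_range: "\<forall>w \<in> space M. U w \<in> {0<..<1}"
    and V_range: "\<forall>w \<in> space M. V w \<in> {0<..<1}"
    and indep: "prob_space.indep_var M borel U borel V"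
    and U_unif: "distr M borel U = uniform_measure lborel {0<..<1}"
    and V_unif: "distr M borel V = uniform_measure lborel {0<..<1}"
    and T: "\<forall>u \<in> {0<..<1}. T u = R_fun \<mu> \<nu> u"
    and X: "\<forall>w \<in> space M. X w = quantile \<mu> (U w)"
    and Y: "\<forall>w \<in> space M. Y w = T (U w)"
  shows "antimono_on {0<..<1} T
    \<and> (\<forall>u \<in> {0<..<1}. T u < quantile \<mu> u)
    \<and> two_step_supermartingale M
         (vimage_algebra (space M) U borel)
         (vimage_algebra (space M) (\<lambda>w. (U w, V w)) (borel \<Otimes>\<^sub>M borel)) X Y
    \<and> distr M borel X = \<mu>
    \<and> distr M borel Y = \<nu>
    \<and> (\<forall>u \<in> {0<..<1}. \<forall>B \<in> sets borel.
         measure M {w \<in> space M. U w \<le> u \<and> Y w \<in> B} = measure (shadow \<nu> (left_part \<mu> u)) B)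
    \<and> distr M borel (\<lambda>w. (U w, X w, Y w))
        = distr M borel (\<lambda>w. (U w, quantile \<mu> (U w), quantile \<nu> (1 - U w)))"
proof -
  interpret prob_space M by (rule prob)
  have \<mu>: "real_distribution \<mu>" "\<mu> \<in> fin_moment" and \<nu>: "real_distribution \<nu>" "\<nu> \<in> fin_moment"
    using mu nu
    by (auto simp: prob_fin_moment_def fin_moment_def real_distribution_def real_distribution_axioms_def)
  obtain l where left: "left_end \<mu> = ereal l"
    and l: "emeasure \<mu> {..<l} = 0" "emeasure \<nu> {l<..} = 0"
    using separating_point[OF \<mu>(1) \<nu>(1) ends] .
  have atom: "measure \<mu> {l} = 0 \<or> measure \<nu> {l} = 0"
    using no_common_atom by (auto simp: left min_def split: if_splits)
  have sep: "quantile \<nu> (1 - u) \<le> l" "quantile \<nu> (1 - u) < quantile \<mu> u" if "u \<in> {0<..<1}" for u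
    using quantiles_separated[OF \<mu>(1) \<nu>(1) l atom] that by auto
  have T_eq: "T u = quantile \<nu> (1 - u)" if "u \<in> {0<..<1}" for u
    using R_fun_eq_quantile[OF \<mu> \<nu> l _ _ sep[OF that]] T that by auto
  have anti: "antimono_on {0<..<1} T"
    by (rule monotone_onI) (auto simp: T_eq intro!: quantile_mono[OF \<nu>(1)])
  have T_less: "\<forall>u \<in> {0<..<1}. T u < quantile \<mu> u"
    using sep T_eq by simp
  have Y_eq: "Y w = quantile \<nu> (1 - U w)" if "w \<in> space M" for w
    using that Y T_eq U_range by simp
  have U: "U \<in> borel_measurable M" and V: "V \<in> borel_measurable M"
    using indep_var_rv1[OF indep] indep_var_rv2[OF indep] by auto
  note unif = uniform_distr_probs[OF U U_unif]
  let ?F1 = "vimage_algebra (space M) U borel"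
  have U1: "U \<in> borel_measurable ?F1" by (rule measurable_vimage_algebra1) simp
  have "(\<lambda>w. quantile \<mu> (U w)) \<in> borel_measurable ?F1"
    using U_range by (intro measurable_quantile_compose[OF \<mu>(1) U1]) auto
  hence X1: "X \<in> borel_measurable ?F1"
    using X by (subst measurable_cong[where g = "\<lambda>w. quantile \<mu> (U w)"]) auto
  have "(\<lambda>w. quantile \<nu> (1 - U w)) \<in> borel_measurable ?F1"
    using U_range U1 by (intro measurable_quantile_compose[OF \<nu>(1)]) auto
  hence Y1: "Y \<in> borel_measurable ?F1"
    using Y_eq by (subst measurable_cong[where g = "\<lambda>w. quantile \<nu> (1 - U w)"]) auto
  have sub: "subalgebra M ?F1"
    using U by (simp add: subalgebra_def measurable_iff_sets)
  note XM = measurable_from_subalg[OF sub X1] and YM = measurable_from_subalg[OF sub Y1]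
  have "distr M borel X = distr M borel (\<lambda>w. quantile \<mu> (U w))"
    using X by (intro distr_cong) auto
  also have "\<dots> = \<mu>"
    using U U_range unif(1) by (intro distr_quantile_uniform[OF \<mu>(1)]) auto
  finally have lawX: "distr M borel X = \<mu>" .
  have "distr M borel Y = distr M borel (\<lambda>w. quantile \<nu> (1 - U w))"
    using Y_eq by (intro distr_cong) auto
  also have "\<dots> = \<nu>"
    using U U_range unif(2) by (intro distr_quantile_uniform[OF \<nu>(1)]) auto
  finally have lawY: "distr M borel Y = \<nu>" .
  have "integrable (distr M borel X) (\<lambda>x. x)" "integrable (distr M borel Y) (\<lambda>x. x)"
    using \<mu>(2) \<nu>(2) by (simp_all add: lawX lawY fin_moment_def)
  hence int: "integrable M X" "integrable M Y"
    using integrable_distr[OF XM] integrable_distr[OF YM] by blast+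
  have super: "two_step_supermartingale M ?F1
      (vimage_algebra (space M) (\<lambda>w. (U w, V w)) (borel \<Otimes>\<^sub>M borel)) X Y"
    using U V X1 int(1) Y1 int(2)
  proof (rule two_step_supermartingaleI)
    fix w assume "w \<in> space M"
    thus "Y w \<le> X w" using T_less X Y U_range by (simp add: less_imp_le)
  qed
  have shadow: "measure M {w \<in> space M. U w \<le> u \<and> Y w \<in> B} = measure (shadow \<nu> (left_part \<mu> u)) B"
    if "u \<in> {0<..<1}" "B \<in> sets borel" for u B
    using shadow_left_part_eq_restricted_law[OF \<mu> \<nu> l U _ unif(1) YM Y_eq lawY _ _ that(2)]
      U_range that(1) by auto
  have joint: "distr M borel (\<lambda>w. (U w, X w, Y w))
      = distr M borel (\<lambda>w. (U w, quantile \<mu> (U w), quantile \<nu> (1 - U w)))"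
    using X Y_eq by (intro distr_cong) auto
  show ?thesis
    using anti T_less super lawX lawY shadow joint by blast
qed

end
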